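(* Let $N\ge 1$ and let $a,b\ge 0$ be integers with $a+b\le N$. Consider the 2-type totally asymmetric exclusion process (TASEP) on the cycle $\mathbb{Z}_N$ restricted to the states having exactly $a$ particles and exactly $b$ anti-particles. Let $S$ and $T$ be chosen independently, with $S$ uniform among all subsets of $\mathbb{Z}_N$ of size $a$ and $T$ uniform among all subsets of $\mathbb{Z}_N$ of size $b$ (i.e. the pair $(S,T)$ is uniform among all $\binom{N}{a}\binom{N}{b}$ such pairs; $S$ and $T$ need not be disjoint). Then the stationary measure (the unique stationary distribution) of this process is the law of the state obtained by collapsing $(S,T)$.
   Context: States. $\mathbb{Z}_N$ is the cycle of integers modulo $N$; the position to the right of $i$ is $i+1$ and the position to its left is $i-1$ (mod $N$). A state is a map $x:\mathbb{Z}_N\to\{\mathtt{0},\mathtt{*},\mathtt{1}\}$, where $\mathtt{1}$ denotes a particle, $\mathtt{0}$ an anti-particle and $\mathtt{*}$ an empty site. Dynamics (2-type TASEP). This is the continuous-time Markov chain in which each edge $(i,i+1)$ is chosen at rate 1, independently of the other edges. When the edge is chosen, the values $(x(i),x(i+1))$ are updated by: $(\mathtt{1},\mathtt{*})\mapsto(\mathtt{*},\mathtt{1})$ (a particle moves right into an empty site), $(\mathtt{*},\mathtt{0})\mapsto(\mathtt{0},\mathtt{*})$ (an anti-particle moves left into an empty site), $(\mathtt{1},\mathtt{0})\mapsto(\mathtt{0},\mathtt{1})$ (a particle and an anti-particle exchange positions); otherwise nothing happens. The numbers of particles and of anti-particles are conserved. (Equivalently, this is the TASEP with second class particles: $\mathtt{1}$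 = first class particle, $\mathtt{*}$ = second class particle, $\mathtt{0}$ = empty position.) Collapsing. Let $S,T\subseteq\mathbb{Z}_N$ (not necessarily disjoint) with $|S|+|T|\le N$. The pair $(S,T)$ collapses to the state $x$ obtained as follows. First, anti-particles are placed at all positions of $T$. Next, the positions in $S$ are considered one after another in an arbitrary order: if the position considered is currently empty, a particle is placed there; otherwise a particle is placed in the nearest currently empty position to the left (cyclically) of the specified position. The final state does not depend on the order. Equivalently: the anti-particles of $x$ are exactly at the positions of $T$; a position $c$ contains a particle if and only if $c\notin T$ and there is a (cyclic) interval $I=[c,d]=\{c,c+1,\dots,d\}$ with $|I\cap S|+|I\cap T|\ge |I|$; all other positions are empty. *)

theory Defs
  imports "HOL-Probability.Probability"
begin

text \<open>
  The cycle is \<open>{..<N}\<close> with arithmetic modulo \<open>N\<close>. States are extensional functions on it,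
  so that two states are equal as soon as they agree on the cycle.
\<close>

datatype site = Antiparticle | Vacant | Particle

definition right_of :: "nat \<Rightarrow> nat \<Rightarrow> nat" where
  "right_of N i = (i + 1) mod N"

definition left_of :: "nat \<Rightarrow> nat \<Rightarrow> nat" where
  "left_of N i = (i + N - 1) mod N"

definition states :: "nat \<Rightarrow> nat \<Rightarrow> nat \<Rightarrow> (nat \<Rightarrow> site) set" where
  "states N a b = {x \<in> {..<N} \<rightarrow>\<^sub>E UNIV.
     card {i \<in> {..<N}. x i = Particle} = a \<and> card {i \<in> {..<N}. x i = Antiparticle} = b}"

fun edge_rule :: "site \<times> site \<Rightarrow> site \<times> site" where
  "edge_rule (Particle, Vacant) = (Vacant, Particle)"
| "edge_rule (Vacant, Antiparticle) = (Antiparticle, Vacant)"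
| "edge_rule (Particle, Antiparticle) = (Antiparticle, Particle)"
| "edge_rule p = p"

definition edge_update :: "nat \<Rightarrow> nat \<Rightarrow> (nat \<Rightarrow> site) \<Rightarrow> nat \<Rightarrow> site" where
  "edge_update N i x =
     (let (u, v) = edge_rule (x i, x (right_of N i)) in x(i := u, right_of N i := v))"

definition tasep_jump :: "nat \<Rightarrow> (nat \<Rightarrow> site) \<Rightarrow> (nat \<Rightarrow> site) pmf" where
  "tasep_jump N x = map_pmf (\<lambda>i. edge_update N i x) (pmf_of_set {..<N})"

text \<open>
  The law at time \<open>t\<close> of the continuous-time chain started from \<open>x\<close>. Each of the \<open>N\<close> edges is
  chosen at the times of a Poisson process of rate 1, independently of the others. Hence the
  total number of choices made during \<open>[0, t]\<close> is Poisson distributed with mean \<open>N t\<close>, and given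
  this number the successively chosen edges are independent and uniform.
  The parameter of \<^const>\<open>poisson_pmf\<close> has to be positive, so this is meaningful for \<open>N > 0\<close>
  and \<open>t > 0\<close>.
\<close>

definition tasep_transition :: "nat \<Rightarrow> real \<Rightarrow> (nat \<Rightarrow> site) \<Rightarrow> (nat \<Rightarrow> site) pmf" where
  "tasep_transition N t x =
     bind_pmf (poisson_pmf (real N * t))
       (\<lambda>n. ((\<lambda>\<nu>. bind_pmf \<nu> (tasep_jump N)) ^^ n) (return_pmf x))"

definition tasep_stationary :: "nat \<Rightarrow> nat \<Rightarrow> nat \<Rightarrow> (nat \<Rightarrow> site) pmf \<Rightarrow> bool" where
  "tasep_stationary N a b \<mu> \<longleftrightarrow>
     set_pmf \<mu> \<subseteq> states N a b \<and> (\<forall>t>0. bind_pmf \<mu> (tasep_transition N t) = \<mu>)"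

text \<open>
  If no position is vacant, \<open>place_particle\<close> changes nothing; this case does not arise when
  collapsing a pair \<open>(S, T)\<close> with \<open>card S + card T \<le> N\<close>.
\<close>

definition place_particle :: "nat \<Rightarrow> nat \<Rightarrow> (nat \<Rightarrow> site) \<Rightarrow> nat \<Rightarrow> site" where
  "place_particle N p x =
     (if \<exists>k. x ((left_of N ^^ k) p) = Vacant
      then x((left_of N ^^ (LEAST k. x ((left_of N ^^ k) p) = Vacant)) p := Particle)
      else x)"

definition place_antiparticles :: "nat \<Rightarrow> nat set \<Rightarrow> nat \<Rightarrow> site" where
  "place_antiparticles N T = (\<lambda>i\<in>{..<N}. if i \<in> T then Antiparticle else Vacant)"

text \<open>The positions in \<open>S\<close> are considered in increasing order; any other order gives the same
  state, see \<open>collapse_any_order\<close> below.\<close>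

definition collapse :: "nat \<Rightarrow> nat set \<Rightarrow> nat set \<Rightarrow> nat \<Rightarrow> site" where
  "collapse N S T = fold (place_particle N) (sorted_list_of_set S) (place_antiparticles N T)"

lemma place_particle_at:
  assumes "x ((left_of N ^^ k) p) = Vacant" "\<And>j. j < k \<Longrightarrow> x ((left_of N ^^ j) p) \<noteq> Vacant"
  shows "place_particle N p x = x((left_of N ^^ k) p := Particle)"
proof -
  have "(LEAST k. x ((left_of N ^^ k) p) = Vacant) = k"
    using assms by (intro Least_equality) (auto simp: not_less[symmetric])
  with assms(1) show ?thesis
    unfolding place_particle_def by auto
qed

lemma place_particle_none:
  assumes "\<And>k. x ((left_of N ^^ k) p) \<noteq> Vacant"
  shows "place_particle N p x = x"
  using assms unfolding place_particle_def by auto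

lemma place_particle_cases:
  obtains (none) "\<And>k. x ((left_of N ^^ k) p) \<noteq> Vacant"
  | (at) k where "x ((left_of N ^^ k) p) = Vacant"
      "\<And>j. j < k \<Longrightarrow> x ((left_of N ^^ j) p) \<noteq> Vacant"
proof (cases "\<exists>k. x ((left_of N ^^ k) p) = Vacant")
  case True
  then show ?thesis
    using at[OF LeastI_ex[OF True]] not_less_Least by blast
next
  case False
  then show ?thesis using none by blast
qed

lemma place_particle_skip:
  assumes "\<And>j. j < m \<Longrightarrow> x ((left_of N ^^ j) p) \<noteq> Vacant"
  shows "place_particle N p x = place_particle N ((left_of N ^^ m) p) x"
proof (cases x N "(left_of N ^^ m) p" rule: place_particle_cases)
  case none
  have "x ((left_of N ^^ k) p) \<noteq> Vacant" for k
  proof (cases "k < m")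
    case False
    then show ?thesis
      using none[of "k - m"] by (simp flip: funpow_add o_apply[of "left_of N ^^ _"])
  qed (use assms in auto)
  then show ?thesis
    by (simp add: place_particle_none none)
next
  case (at k)
  have *: "(left_of N ^^ (k + m)) p = (left_of N ^^ k) ((left_of N ^^ m) p)"
    by (simp add: funpow_add)
  have "x ((left_of N ^^ j) p) \<noteq> Vacant" if "j < k + m" for j
  proof (cases "j < m")
    case False
    then show ?thesis
      using at(2)[of "j - m"] that by (simp flip: funpow_add o_apply[of "left_of N ^^ _"])
  qed (use assms in auto)
  then have "place_particle N p x = x((left_of N ^^ (k + m)) p := Particle)"
    using at(1) by (intro place_particle_at) (auto simp: *)
  then show ?thesis
    using at by (simp add: place_particle_at *)
qed

lemma place_particle_commute:
  "place_particle N p (place_particle N q x) = place_particle N q (place_particle N p x)"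
proof (cases x N p rule: place_particle_cases)
  case none
  have "place_particle N q x = x \<or> (\<exists>c. place_particle N q x = x(c := Particle))"
    unfolding place_particle_def by auto
  then have "place_particle N p (place_particle N q x) = place_particle N q x"
    by (intro place_particle_none) (use none in \<open>auto split: if_splits\<close>)
  with none show ?thesis by (simp add: place_particle_none)
next
  case p: (at k)
  have pp: "place_particle N p x = x((left_of N ^^ k) p := Particle)"
    using p by (intro place_particle_at) auto
  show ?thesis
  proof (cases x N q rule: place_particle_cases)
    case none
    have "place_particle N q (place_particle N p x) = place_particle N p x"
      unfolding pp
      by (intro place_particle_none) (use none in \<open>auto split: if_splits\<close>)
    with none show ?thesis by (simp add: place_particle_none)
  next
    case q: (at l)
    have qq: "place_particle N q x = x((left_of N ^^ l) q := Particle)"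
      using q by (intro place_particle_at) auto
    let ?c = "(left_of N ^^ k) p" and ?d = "(left_of N ^^ l) q"
    show ?thesis
    proof (cases "?c = ?d")
      case True
      have "place_particle N p (x(?c := Particle)) = place_particle N ?c (x(?c := Particle))"
        by (intro place_particle_skip) (use p in auto)
      moreover have "place_particle N q (x(?c := Particle)) = place_particle N ?c (x(?c := Particle))"
        unfolding True by (intro place_particle_skip) (use q in auto)
      ultimately show ?thesis
        using pp qq True by simp
    next
      case False
      have "place_particle N p (x(?d := Particle)) = x(?d := Particle, ?c := Particle)"
        by (intro place_particle_at) (use p False in auto)
      moreover have "place_particle N q (x(?c := Particle)) = x(?c := Particle, ?d := Particle)"
        by (intro place_particle_at) (use q False in auto)
      ultimately show ?thesis
        using pp qq False by (simp add: fun_upd_twist)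
    qed
  qed
qed

lemma collapse_any_order:
  assumes "distinct ps" "set ps = S"
  shows "collapse N S T = fold (place_particle N) ps (place_antiparticles N T)"
proof -
  have "mset (sorted_list_of_set S) = mset ps"
    using assms by (metis List.finite_set distinct_sorted_list_of_set set_eq_iff_mset_eq_distinct
      set_sorted_list_of_set)
  then have "fold (place_particle N) (sorted_list_of_set S) = fold (place_particle N) ps"
    by (intro fold_multiset_equiv) (auto simp: fun_eq_iff place_particle_commute)
  then show ?thesis by (simp add: collapse_def)
qed

definition collapse_law :: "nat \<Rightarrow> nat \<Rightarrow> nat \<Rightarrow> (nat \<Rightarrow> site) pmf" where
  "collapse_law N a b =
     map_pmf (\<lambda>(S, T). collapse N S T)
       (pair_pmf (pmf_of_set {S. S \<subseteq> {..<N} \<and> card S = a})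
                 (pmf_of_set {T. T \<subseteq> {..<N} \<and> card T = b}))"

end

theory Submission
  imports Defs
begin

text \<open>
  Why the theorem is true. The 2-type process is the image under collapsing of a Markov chain on
  the pairs \<open>(S, T)\<close> that preserves the uniform law (the multi-line process of Ferrari and
  Martin). When edge \<open>i\<close> is chosen, the complement of \<open>T\<close> makes an ordinary one-type TASEP jump
  along \<open>i\<close>, and then \<open>S\<close> makes a TASEP jump along \<open>i\<close>, or along the edge to its left if
  \<open>i \<in> T\<close>. Two facts make this work.

  First, the chain can be made invertible. Carry a mark: a one-type jump sends the mark \<open>i\<close> to
  \<open>i + 1\<close> if \<open>i\<close> was occupied and leaves it at \<open>i\<close> otherwise. The pair of configuration and mark
  is then a record from which the jump can be undone (\<open>jump_mark_inject\<close>), since the new mark is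
  occupied exactly when the old one was. Using the mark that leaves the lower line to choose the
  edge for the upper line gives a bijection on the triples \<open>(S, T, i)\<close> with prescribed
  cardinalities (\<open>bij_betw_two_line_step\<close>). A bijection preserves the uniform law of the triple,
  and forgetting the mark shows that the uniform law of \<open>(S, T)\<close> is preserved.

  Second, one step of this chain collapses to the update of the collapsed state along edge \<open>i\<close>
  (\<open>edge_update_collapse\<close>). The reason is that placing a particle commutes with updating the edge
  \<open>i\<close>, unless the particle is specified at \<open>i\<close> itself (\<open>place_particle_edge_update\<close>): a search
  that starts elsewhere meets \<open>i + 1\<close> before \<open>i\<close>. As the order of \<open>S\<close> is immaterial, the
  position \<open>i\<close>, and \<open>i + 1\<close> with it if both are in \<open>S\<close>, can be treated first, directly on the
  antiparticles.

  So the collapse law is invariant under one uniformly chosen edge update, hence under any number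
  of them, and hence under the process in continuous time. For uniqueness, every state can be
  sorted by updates that never use the edge from \<open>N - 1\<close> to \<open>0\<close>, so one fixed state has positive
  transition probability from all states at time \<open>1\<close>; such a kernel on a finite set is a strict
  contraction on signed measures of total mass zero (\<open>invariant_pmf_unique\<close>).
\<close>

section \<open>Moving around the cycle\<close>

lemma right_of_less: "i < N \<Longrightarrow> right_of N i < N"
  by (simp add: right_of_def)

lemma left_of_less: "i < N \<Longrightarrow> left_of N i < N"
  by (simp add: left_of_def)

lemma left_of_right_of [simp]: "i < N \<Longrightarrow> left_of N (right_of N i) = i"
  by (cases "i + 1 = N") (auto simp: left_of_def right_of_def)

lemma left_of_Suc: "Suc i < N \<Longrightarrow> left_of N (Suc i) = i"
  by (simp add: left_of_def)

lemma right_of_left_of [simp]: "i < N \<Longrightarrow> right_of N (left_of N i) = i"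
  by (cases i) (auto simp: left_of_Suc, auto simp: left_of_def right_of_def)

lemma funpow_left_of_less: "p < N \<Longrightarrow> (left_of N ^^ k) p < N"
  by (induction k) (auto simp: left_of_less)

lemma funpow_left_of_eq_diff: "p < N \<Longrightarrow> k \<le> p \<Longrightarrow> (left_of N ^^ k) p = p - k"
proof (induction k)
  case (Suc k)
  then have "left_of N (p - k) = p - Suc k"
    using left_of_Suc[of "p - Suc k" N] by (simp add: Suc_diff_Suc)
  with Suc show ?case by simp
qed simp

lemma left_of_reaches:
  assumes "p < N" "q < N"
  obtains k where "(left_of N ^^ k) p = q"
proof
  have "left_of N 0 = N - 1"
    using assms by (simp add: left_of_def)
  then have "(left_of N ^^ Suc p) p = N - 1"
    using assms by (simp add: funpow_left_of_eq_diff)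
  then show "(left_of N ^^ ((N - 1 - q) + Suc p)) p = q"
    using assms by (simp only: funpow_add o_apply) (simp add: funpow_left_of_eq_diff)
qed

section \<open>Edge updates and placing particles\<close>

lemma edge_rule_swap: "edge_rule (u, v) = (u, v) \<or> edge_rule (u, v) = (v, u)"
  by (cases u; cases v) auto

lemma edge_update_swap:
  "edge_update N i x = x \<or> edge_update N i x = x(i := x (right_of N i), right_of N i := x i)"
  using edge_rule_swap[of "x i" "x (right_of N i)"] by (auto simp: edge_update_def)

lemma edge_update_other:
  "p \<noteq> i \<Longrightarrow> p \<noteq> right_of N i \<Longrightarrow> edge_update N i x p = x p"
  by (auto simp: edge_update_def split: prod.splits)

lemma edge_update_upd_other:
  "p \<noteq> i \<Longrightarrow> p \<noteq> right_of N i \<Longrightarrow>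
     edge_update N i (x(p := u)) = (edge_update N i x)(p := u)"
  by (auto simp: edge_update_def fun_eq_iff split: prod.splits)

lemma place_particle_here: "x p = Vacant \<Longrightarrow> place_particle N p x = x(p := Particle)"
  using place_particle_at[where k = 0] by simp

lemma place_particle_occupied:
  "x p \<noteq> Vacant \<Longrightarrow> place_particle N p x = place_particle N (left_of N p) x"
  using place_particle_skip[of 1 x N p] by simp

lemma place_particle_other:
  "x p \<noteq> Vacant \<Longrightarrow> place_particle N q x p = x p"
  by (cases x N q rule: place_particle_cases) (auto simp: place_particle_none place_particle_at)

text \<open>
  If both ends of the edge are occupied, the update only exchanges nonvacant values, and any search
  for a vacancy ends at the same place before and after.
\<close>

lemma place_particle_edge_update_occupied:
  assumes "x i \<noteq> Vacant" "x (right_of N i) \<noteq> Vacant"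
  shows "place_particle N s (edge_update N i x) = edge_update N i (place_particle N s x)"
proof -
  let ?E = "edge_update N i"
  have vac: "?E x p = Vacant \<longleftrightarrow> x p = Vacant" for p
    using assms edge_update_swap[of N i x] by (auto split: if_splits)
  show ?thesis
  proof (cases x N s rule: place_particle_cases)
    case none
    then show ?thesis by (simp add: place_particle_none vac)
  next
    case (at k)
    have "(left_of N ^^ k) s \<noteq> i" "(left_of N ^^ k) s \<noteq> right_of N i"
      using at assms by auto
    with at show ?thesis
      by (simp add: place_particle_at vac edge_update_upd_other)
  qed
qed

text \<open>
  If one end of the edge is vacant, the search from the right end stops on the edge, and a check of
  the possible values settles the claim. For instance, a particle at \<open>i\<close> and a vacancy at
  \<open>i + 1\<close> end as two particles whether the particle jumps before or after the placement.
\<close>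

lemma place_particle_edge_update_right:
  assumes "i < N" "right_of N i \<noteq> i"
  shows "place_particle N (right_of N i) (edge_update N i x) =
         edge_update N i (place_particle N (right_of N i) x)"
proof -
  let ?r = "right_of N i"
  show ?thesis
  proof (cases "x i \<noteq> Vacant \<and> x ?r \<noteq> Vacant")
    case True
    then show ?thesis by (simp add: place_particle_edge_update_occupied)
  next
    case False
    have two_sites: "place_particle N ?r z = (if z ?r = Vacant then z(?r := Particle) else z(i := Particle))"
      if "z i = Vacant \<or> z ?r = Vacant" for z
      using that place_particle_occupied[of z ?r N] assms by (auto simp: place_particle_here)
    have "edge_update N i x i = Vacant \<or> edge_update N i x ?r = Vacant"
      using False edge_update_swap[of N i x] assms by auto
    with False two_sites[of x] two_sites[of "edge_update N i x"] show ?thesis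
      using assms
      by (cases "x i"; cases "x ?r") (auto simp: edge_update_def fun_eq_iff)
  qed
qed

text \<open>
  The search from \<open>s \<noteq> i\<close> to the left reaches \<open>i + 1\<close> before \<open>i\<close>. Up to that point the update of
  edge \<open>i\<close> is invisible, so the search may be taken to start at \<open>i + 1\<close>. The restriction is
  essential: a particle placed at a vacant \<open>i\<close> next to a vacant \<open>i + 1\<close> jumps in the update.
\<close>

lemma place_particle_edge_update:
  assumes "i < N" "s < N" "s \<noteq> i"
  shows "place_particle N s (edge_update N i x) = edge_update N i (place_particle N s x)"
proof -
  let ?r = "right_of N i" and ?E = "edge_update N i"
  \<comment> \<open>the edge is a loop only if \<open>N = 1\<close>, and then there is no \<open>s \<noteq> i\<close>\<close>
  have ri: "?r \<noteq> i"
  proof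
    assume "?r = i"
    then have "N = 1" using assms by (cases "i + 1 = N") (auto simp: right_of_def)
    with assms show False by simp
  qed
  have "\<exists>k. (left_of N ^^ k) s = ?r"
    using left_of_reaches[of s N ?r] assms right_of_less by metis
  then obtain m where m: "(left_of N ^^ m) s = ?r" "\<And>j. j < m \<Longrightarrow> (left_of N ^^ j) s \<noteq> ?r"
    using exists_least_iff[of "\<lambda>k. (left_of N ^^ k) s = ?r"] by blast
  have not_i: "(left_of N ^^ j) s \<noteq> i" if "j < m" for j
  proof (cases j)
    case (Suc l)
    show ?thesis
    proof
      assume "(left_of N ^^ j) s = i"
      then have "right_of N (left_of N ((left_of N ^^ l) s)) = ?r" using Suc by simp
      then have "(left_of N ^^ l) s = ?r" using assms by (simp add: funpow_left_of_less)
      then show False using m(2)[of l] that Suc by simp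
    qed
  qed (use assms in simp)
  have same: "?E x ((left_of N ^^ j) s) = x ((left_of N ^^ j) s)" if "j < m" for j
    using that m(2) not_i by (simp add: edge_update_other)
  show ?thesis
  proof (cases "\<exists>j<m. x ((left_of N ^^ j) s) = Vacant")
    case True
    then obtain k where k: "k < m" "x ((left_of N ^^ k) s) = Vacant"
        "\<And>j. j < k \<Longrightarrow> x ((left_of N ^^ j) s) \<noteq> Vacant"
      using exists_least_iff[of "\<lambda>j. j < m \<and> x ((left_of N ^^ j) s) = Vacant"]
      by (metis order_less_trans)
    have "place_particle N s (?E x) = (?E x)((left_of N ^^ k) s := Particle)"
      by (intro place_particle_at) (use k same in auto)
    moreover have "place_particle N s x = x((left_of N ^^ k) s := Particle)"
      by (intro place_particle_at) (use k in auto)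
    ultimately show ?thesis
      using k m(2) not_i by (simp add: edge_update_upd_other)
  next
    case False
    have "place_particle N s x = place_particle N ?r x"
      using place_particle_skip[of m x N s] False m(1) by auto
    moreover have "place_particle N s (?E x) = place_particle N ?r (?E x)"
      using place_particle_skip[of m "?E x" N s] False m(1) same by auto
    ultimately show ?thesis
      using place_particle_edge_update_right[OF assms(1) ri] by simp
  qed
qed

lemma fold_place_particle_edge_update:
  assumes "i < N" "set ps \<subseteq> {..<N} - {i}"
  shows "fold (place_particle N) ps (edge_update N i x) =
         edge_update N i (fold (place_particle N) ps x)"
  using assms(2) by (induction ps arbitrary: x) (auto simp: place_particle_edge_update assms(1))

lemma fold_place_particle_other:
  "x p \<noteq> Vacant \<Longrightarrow> fold (place_particle N) ps x p = x p"
  by (induction ps arbitrary: x) (auto simp: place_particle_other)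

section \<open>A bijection on pairs of sets with a mark\<close>

text \<open>
  The ordinary TASEP move of the particle configuration \<open>A\<close> along edge \<open>i\<close>, and the record kept
  of it. For a fixed edge the move alone is not injective: a particle found at \<open>i + 1\<close> behind a
  vacant \<open>i\<close> may have been there before.
\<close>

definition jump :: "nat \<Rightarrow> nat set \<Rightarrow> nat \<Rightarrow> nat set" where
  "jump N A i = (if i \<in> A \<and> right_of N i \<notin> A then insert (right_of N i) (A - {i}) else A)"

definition mark :: "nat \<Rightarrow> nat set \<Rightarrow> nat \<Rightarrow> nat" where
  "mark N A i = (if i \<in> A then right_of N i else i)"

lemma mark_less: "i < N \<Longrightarrow> mark N A i < N"
  by (simp add: mark_def right_of_less)

lemma jump_subset: "i < N \<Longrightarrow> A \<subseteq> {..<N} \<Longrightarrow> jump N A i \<subseteq> {..<N}"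
  by (auto simp: jump_def right_of_less)

lemma card_insert_Diff_singleton:
  assumes "finite A" "x \<in> A" "y \<notin> A"
  shows "card (insert y (A - {x})) = card A"
proof -
  have "card (insert y (A - {x})) = Suc (card (A - {x}))"
    using assms by (intro card_insert_disjoint) auto
  also have "\<dots> = card A"
    using assms(1,2) by (rule card_Suc_Diff1)
  finally show ?thesis .
qed

lemma card_jump: "finite A \<Longrightarrow> card (jump N A i) = card A"
  by (auto simp only: jump_def card_insert_Diff_singleton simp_thms split: if_split)

text \<open>
  The mark moves together with the particle, or with the particle's attempt. So the new mark is
  occupied exactly when the old one was. If it is occupied, the old mark is its left neighbour, and
  the particle came from there unless that site is still occupied.
\<close>

lemma jump_mark_inject:
  assumes "i < N" "j < N" "jump N A i = jump N B j" "mark N A i = mark N B j"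
  shows "A = B \<and> i = j"
proof -
  define undo where "undo = (\<lambda>(A', k). if k \<notin> A' then (A', k)
    else (if left_of N k \<in> A' then A' else insert (left_of N k) (A' - {k}), left_of N k))"
  have undo: "undo (jump N A i, mark N A i) = (A, i)" if "i < N" for A i
  proof -
    consider "i \<notin> A" | "i \<in> A" "right_of N i \<in> A"
      | "i \<in> A" "right_of N i \<notin> A" "right_of N i \<noteq> i" by metis
    then show ?thesis
      using that by cases (auto simp: undo_def jump_def mark_def)
  qed
  have "(A, i) = undo (jump N A i, mark N A i)"
    using undo[OF assms(1)] ..
  also have "\<dots> = (B, j)"
    unfolding assms(3,4) by (rule undo[OF assms(2)])
  finally show ?thesis by simp
qed

text \<open>
  The lower line is the complement of \<open>T\<close>: the sites able to serve a particle of \<open>S\<close>. The upper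
  line uses the left neighbour of the mark produced by the lower line, which is \<open>i\<close> if \<open>i\<close> can
  serve and \<open>i - 1\<close> if not. In the latter case a particle of \<open>S\<close> can only move from \<open>i - 1\<close> to the
  antiparticle at \<open>i\<close>, which is invisible after collapsing.
\<close>

definition lower_jump :: "nat \<Rightarrow> nat set \<Rightarrow> nat \<Rightarrow> nat set" where
  "lower_jump N T i = - jump N (- T) i"

definition upper_edge :: "nat \<Rightarrow> nat set \<Rightarrow> nat \<Rightarrow> nat" where
  "upper_edge N T i = left_of N (mark N (- T) i)"

definition two_line_step :: "nat \<Rightarrow> (nat set \<times> nat set) \<times> nat \<Rightarrow> (nat set \<times> nat set) \<times> nat" where
  "two_line_step N = (\<lambda>((S, T), i).
     let j = upper_edge N T i in ((jump N S j, lower_jump N T i), mark N S j))"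

lemma lower_jump_eq:
  "lower_jump N T i =
     (if i \<notin> T \<and> right_of N i \<in> T then insert i (T - {right_of N i}) else T)"
  by (auto simp: lower_jump_def jump_def)

lemma upper_edge_eq:
  "i < N \<Longrightarrow> upper_edge N T i = (if i \<in> T then left_of N i else i)"
  by (auto simp: upper_edge_def mark_def)

lemma upper_edge_less: "i < N \<Longrightarrow> upper_edge N T i < N"
  by (simp add: upper_edge_eq left_of_less)

lemma lower_jump_subset: "i < N \<Longrightarrow> T \<subseteq> {..<N} \<Longrightarrow> lower_jump N T i \<subseteq> {..<N}"
  by (auto simp: lower_jump_eq)

lemma card_lower_jump: "finite T \<Longrightarrow> card (lower_jump N T i) = card T"
  by (auto simp only: lower_jump_eq card_insert_Diff_singleton simp_thms split: if_split)

lemma left_of_inject: "i < N \<Longrightarrow> j < N \<Longrightarrow> left_of N i = left_of N j \<Longrightarrow> i = j"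
  by (drule arg_cong[of _ _ "right_of N"]) simp

text \<open>
  The step is undone line by line, from the upper one to the lower one: undoing the upper jump
  gives back \<open>S\<close> and the edge used there, hence the mark with which the lower jump can be undone.
\<close>

lemma inj_on_two_line_step: "inj_on (two_line_step N) (X \<times> {..<N})"
proof (rule inj_onI, clarsimp simp: two_line_step_def Let_def)
  fix S T i S' T' i'
  assume i: "i < N" "i' < N"
    and S: "jump N S (upper_edge N T i) = jump N S' (upper_edge N T' i')"
      "mark N S (upper_edge N T i) = mark N S' (upper_edge N T' i')"
    and T: "lower_jump N T i = lower_jump N T' i'"
  have *: "S = S'" "upper_edge N T i = upper_edge N T' i'"
    using jump_mark_inject[OF _ _ S] i by (auto simp: upper_edge_less)
  from *(2) have "mark N (- T) i = mark N (- T') i'"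
    unfolding upper_edge_def by (rule left_of_inject[rotated 2]) (use i in \<open>auto simp: mark_less\<close>)
  with T have "- T = - T' \<and> i = i'"
    by (intro jump_mark_inject[OF i]) (auto simp: lower_jump_def)
  with * show "S = S' \<and> T = T' \<and> i = i'" by auto
qed

lemma bij_betw_two_line_step:
  fixes N a b
  defines "Z \<equiv> ({S. S \<subseteq> {..<N} \<and> card S = a} \<times> {T. T \<subseteq> {..<N} \<and> card T = b}) \<times> {..<N}"
  shows "bij_betw (two_line_step N) Z Z"
proof -
  have "finite Z" unfolding Z_def by auto
  moreover have "two_line_step N ` Z \<subseteq> Z"
    unfolding Z_def
    by (auto simp: two_line_step_def Let_def card_jump card_lower_jump finite_subset mark_less upper_edge_less
        dest!: jump_subset[THEN subsetD, rotated 2] lower_jump_subset[THEN subsetD, rotated 2])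
  moreover have "inj_on (two_line_step N) Z" unfolding Z_def by (rule inj_on_two_line_step)
  ultimately show ?thesis
    by (simp add: bij_betw_def endo_inj_surj)
qed

section \<open>Collapsing turns the two-line step into an edge update\<close>

lemma place_antiparticles_lower_jump:
  assumes "i < N"
  shows "place_antiparticles N (lower_jump N T i) = edge_update N i (place_antiparticles N T)"
  using assms right_of_less[OF assms]
  by (auto simp: place_antiparticles_def lower_jump_eq edge_update_def fun_eq_iff)

lemma collapse_place_first:
  assumes "finite R" "distinct ps" "set ps \<inter> R = {}"
  shows "collapse N (set ps \<union> R) T =
    fold (place_particle N) (sorted_list_of_set R)
      (fold (place_particle N) ps (place_antiparticles N T))"
proof -
  have "collapse N (set ps \<union> R) T =
      fold (place_particle N) (ps @ sorted_list_of_set R) (place_antiparticles N T)"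
    using assms by (intro collapse_any_order) auto
  then show ?thesis by simp
qed

text \<open>
  What replaces the commutation of placement and update when the particle is specified at \<open>i\<close>
  itself and is the first to be placed: as \<open>i + 1\<close> is vacant or holds an antiparticle, the update
  moves the particle to \<open>i + 1\<close>. If the update comes first, it leaves \<open>i + 1\<close> vacant, so that a
  particle specified there stays there.
\<close>

lemma edge_update_place_particle_left:
  assumes "i < N" "i \<notin> T"
  shows "edge_update N i (place_particle N i (place_antiparticles N T)) =
         place_particle N (right_of N i) (edge_update N i (place_antiparticles N T))"
proof -
  let ?y = "place_antiparticles N T" and ?r = "right_of N i"
  have "?y i = Vacant" "?y ?r = Vacant \<or> ?y ?r = Antiparticle"
    using assms right_of_less[of i N] by (auto simp: place_antiparticles_def)
  moreover from this have "edge_update N i ?y ?r = Vacant"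
    by (auto simp: edge_update_def)
  ultimately show ?thesis
    by (auto simp: place_particle_here edge_update_def fun_eq_iff)
qed

text \<open>
  If \<open>i \<in> T\<close>, the state does not change, and a particle of \<open>S\<close> specified at \<open>i\<close> is passed on to
  \<open>i - 1\<close> anyway. If \<open>i \<notin> T\<close>, the particle specified at \<open>i\<close>, if any, is placed first, and the
  update is then moved past all the other placements.
\<close>

lemma edge_update_collapse:
  assumes "S \<subseteq> {..<N}" "i < N"
  shows "collapse N (jump N S (upper_edge N T i)) (lower_jump N T i) =
         edge_update N i (collapse N S T)"
proof -
  let ?y = "place_antiparticles N T" and ?E = "edge_update N i" and ?r = "right_of N i"
  let ?F = "fold (place_particle N)"
  have fin: "finite S" using assms(1) finite_subset by blast
  have y': "place_antiparticles N (lower_jump N T i) = ?E ?y"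
    by (rule place_antiparticles_lower_jump[OF assms(2)])
  show ?thesis
  proof (cases "i \<in> T")
    case True
    then have yi: "?y i = Antiparticle" using assms by (simp add: place_antiparticles_def)
    have T': "lower_jump N T i = T" using True by (simp add: lower_jump_eq)
    have up: "upper_edge N T i = left_of N i" using True assms by (simp add: upper_edge_eq)
    have "collapse N S T i = Antiparticle"
      unfolding collapse_def using yi by (simp add: fold_place_particle_other)
    then have "?E (collapse N S T) = collapse N S T"
      by (auto simp: edge_update_def fun_eq_iff)
    moreover have "collapse N (jump N S (left_of N i)) T = collapse N S T"
    proof (cases "left_of N i \<in> S \<and> i \<notin> S")
      case jumps: True
      define R where "R = S - {left_of N i}"
      have "S = set [left_of N i] \<union> R" using jumps by (auto simp: R_def)
      then have "collapse N S T = ?F (sorted_list_of_set R) (place_particle N (left_of N i) ?y)"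
        using fin collapse_place_first[of R "[left_of N i]" N T] by (simp add: R_def)
      moreover have "collapse N (insert i R) T = ?F (sorted_list_of_set R) (place_particle N i ?y)"
        using fin jumps collapse_place_first[of R "[i]" N T] by (simp add: R_def)
      ultimately show ?thesis
        using jumps assms yi by (simp add: jump_def place_particle_occupied[of ?y i] R_def)
    next
      case False
      then show ?thesis using assms by (auto simp: jump_def)
    qed
    ultimately show ?thesis by (simp add: T' up)
  next
    case False
    then have up: "upper_edge N T i = i" using assms by (simp add: upper_edge_eq)
    note base = edge_update_place_particle_left[OF assms(2) False]
    consider "i \<notin> S" | "i \<in> S" "?r \<notin> S" | "i \<in> S" "?r \<in> S" "?r \<noteq> i" | "?r = i" by blast
    then show ?thesis
    proof cases
      case 1
      then have "?F (sorted_list_of_set S) (?E ?y) = ?E (?F (sorted_list_of_set S) ?y)"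
        using assms fin by (intro fold_place_particle_edge_update) auto
      then show ?thesis using 1 by (simp add: jump_def up collapse_def y')
    next
      case 2
      define R where "R = S - {i}"
      have "S = set [i] \<union> R" using 2 by (auto simp: R_def)
      then have "collapse N S T = ?F (sorted_list_of_set R) (place_particle N i ?y)"
        using fin collapse_place_first[of R "[i]" N T] by (simp add: R_def)
      moreover have "collapse N (insert ?r R) (lower_jump N T i) =
          ?F (sorted_list_of_set R) (place_particle N ?r (?E ?y))"
        using fin 2 collapse_place_first[of R "[?r]" N "lower_jump N T i"] y' by (simp add: R_def)
      moreover have "?F (sorted_list_of_set R) (?E (place_particle N i ?y)) =
          ?E (?F (sorted_list_of_set R) (place_particle N i ?y))"
        using fin assms by (intro fold_place_particle_edge_update) (auto simp: R_def)
      ultimately show ?thesis using 2 by (simp add: jump_def up base R_def)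
    next
      case 3
      define R where "R = S - {i, ?r}"
      let ?qs = "sorted_list_of_set R"
      have "S = set [i, ?r] \<union> R" using 3 by (auto simp: R_def)
      then have S: "collapse N S T' = ?F ?qs (?F [i, ?r] (place_antiparticles N T'))" for T'
        using fin 3 collapse_place_first[of R "[i, ?r]" N T'] by (simp add: R_def)
      let ?z = "?E (place_particle N i ?y)"
      \<comment> \<open>After the update \<open>i + 1\<close> is occupied by the particle placed first, so a particle specified
        there and one specified at \<open>i\<close> have the same effect: both elements of \<open>S\<close> may stay.\<close>
      have "place_particle N i ?y i = Particle"
        using False assms by (simp add: place_particle_here place_antiparticles_def)
      then have "?z ?r \<noteq> Vacant"
        using \<open>?r \<noteq> i\<close> by (cases "place_particle N i ?y ?r") (auto simp: edge_update_def)
      then have skip: "place_particle N ?r ?z = place_particle N i ?z"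
        using assms by (simp add: place_particle_occupied[of ?z ?r])
      have "collapse N S (lower_jump N T i) = ?F ?qs (place_particle N i (place_particle N ?r (?E ?y)))"
        by (simp add: S y' place_particle_commute[of N ?r i])
      also have "\<dots> = ?F ?qs (place_particle N ?r ?z)"
        by (simp only: base[symmetric] skip)
      also have "\<dots> = ?F (?r # ?qs) ?z" by simp
      also have "\<dots> = ?E (?F (?r # ?qs) (place_particle N i ?y))"
        using fin assms 3 by (intro fold_place_particle_edge_update) (auto simp: R_def right_of_less)
      finally show ?thesis using 3 by (simp add: jump_def up S)
    next
      case 4
      \<comment> \<open>\<open>N = 1\<close>: the edge is a loop and nothing can happen\<close>
      have "?E x = x" for x using edge_update_swap[of N i x] 4 by auto
      with y' have "collapse N S (lower_jump N T i) = ?E (collapse N S T)"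
        by (simp add: collapse_def)
      with 4 show ?thesis by (simp add: jump_def up)
    qed
  qed
qed

section \<open>Stationarity of the collapse law\<close>

text \<open>
  With \<open>(S, T)\<close> and the edge uniform and independent, the triple is uniform. So is its image under
  the bijection, whose first two components collapse to the updated state.
\<close>

lemma collapse_law_jump_invariant:
  assumes "N \<ge> 1" "a + b \<le> N"
  shows "bind_pmf (collapse_law N a b) (tasep_jump N) = collapse_law N a b"
proof -
  define XS where "XS = {S. S \<subseteq> {..<N} \<and> card S = a}"
  define XT where "XT = {T. T \<subseteq> {..<N} \<and> card T = b}"
  have fin: "finite XS" "finite XT" by (auto simp: XS_def XT_def)
  have ne: "XS \<noteq> {}" "XT \<noteq> {}" "{..<N} \<noteq> {}"
    using obtain_subset_with_card_n[of a "{..<N}"] obtain_subset_with_card_n[of b "{..<N}"] assms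
    by (auto simp: XS_def XT_def lessThan_empty_iff)
  let ?Z = "(XS \<times> XT) \<times> {..<N}"
  let ?p = "pmf_of_set (XS \<times> XT)" and ?c = "\<lambda>(S, T). collapse N S T"
  have pairs: "pair_pmf (pmf_of_set A) (pmf_of_set B) = pmf_of_set (A \<times> B)"
    if "finite A" "finite B" "A \<noteq> {}" "B \<noteq> {}" for A :: "'x set" and B :: "'y set"
  proof (rule pmf_eqI, clarify)
    fix x y
    show "pmf (pair_pmf (pmf_of_set A) (pmf_of_set B)) (x, y) = pmf (pmf_of_set (A \<times> B)) (x, y)"
      using that pmf_of_set[of A] pmf_of_set[of B] pmf_of_set[of "A \<times> B"]
      by (simp add: pmf_pair indicator_def card_cartesian_product)
  qed
  have law: "collapse_law N a b = map_pmf ?c ?p"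
    using fin ne by (simp add: collapse_law_def XS_def[symmetric] XT_def[symmetric] pairs)
  have Z: "pair_pmf ?p (pmf_of_set {..<N}) = pmf_of_set ?Z"
    using fin ne by (intro pairs) auto
  have bij: "bij_betw (two_line_step N) ?Z ?Z"
    unfolding XS_def XT_def by (rule bij_betw_two_line_step)
  have "bind_pmf (collapse_law N a b) (tasep_jump N) =
      map_pmf (\<lambda>(u, i). edge_update N i (?c u)) (pair_pmf ?p (pmf_of_set {..<N}))"
    unfolding law tasep_jump_def pair_pmf_def map_pmf_def
    by (simp add: bind_assoc_pmf bind_return_pmf case_prod_beta)
  also have "\<dots> = map_pmf (\<lambda>(u, i). edge_update N i (?c u)) (pmf_of_set ?Z)"
    by (simp only: Z)
  also have "\<dots> = map_pmf (\<lambda>z. ?c (fst (two_line_step N z))) (pmf_of_set ?Z)"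
    using fin ne
    by (intro map_pmf_cong refl)
       (auto simp: set_pmf_of_set two_line_step_def Let_def edge_update_collapse XS_def)
  also have "\<dots> = map_pmf (\<lambda>z. ?c (fst z)) (map_pmf (two_line_step N) (pmf_of_set ?Z))"
    by (simp add: map_pmf_comp)
  also have "map_pmf (two_line_step N) (pmf_of_set ?Z) = pmf_of_set ?Z"
    using bij fin ne by (subst map_pmf_of_set_inj) (auto simp: bij_betw_def)
  also have "map_pmf (\<lambda>z. ?c (fst z)) (pmf_of_set ?Z) = map_pmf ?c (map_pmf fst (pmf_of_set ?Z))"
    by (simp add: map_pmf_comp)
  also have "map_pmf fst (pmf_of_set ?Z) = ?p"
    unfolding Z[symmetric] by (rule map_fst_pair_pmf)
  finally show ?thesis by (simp add: law)
qed

lemma bind_funpow_bind: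
  fixes K :: "'a \<Rightarrow> 'a pmf"
  shows "bind_pmf \<mu> (\<lambda>x. ((\<lambda>\<nu>. bind_pmf \<nu> K) ^^ n) (return_pmf x)) = ((\<lambda>\<nu>. bind_pmf \<nu> K) ^^ n) \<mu>"
proof (induction n)
  case (Suc n)
  let ?F = "\<lambda>\<nu> :: 'a pmf. bind_pmf \<nu> K"
  have "bind_pmf \<mu> (\<lambda>x. (?F ^^ Suc n) (return_pmf x)) =
      bind_pmf (bind_pmf \<mu> (\<lambda>x. (?F ^^ n) (return_pmf x))) K"
    by (simp add: bind_assoc_pmf)
  with Suc show ?case by simp
qed (simp add: bind_return_pmf')

lemma jump_invariant_transition_invariant:
  assumes "bind_pmf \<mu> (tasep_jump N) = \<mu>"
  shows "bind_pmf \<mu> (tasep_transition N t) = \<mu>"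
proof -
  have "((\<lambda>\<nu>. bind_pmf \<nu> (tasep_jump N)) ^^ n) \<mu> = \<mu>" for n
    by (induction n) (simp_all add: assms)
  then show ?thesis
    unfolding tasep_transition_def
    by (subst bind_commute_pmf) (simp add: bind_funpow_bind)
qed

lemma place_antiparticles_states:
  assumes "T \<subseteq> {..<N}"
  shows "place_antiparticles N T \<in> states N 0 (card T)"
proof -
  have "{i \<in> {..<N}. place_antiparticles N T i = Antiparticle} = T"
    using assms by (auto simp: place_antiparticles_def)
  moreover have "{i \<in> {..<N}. place_antiparticles N T i = Particle} = {}"
    by (auto simp: place_antiparticles_def)
  ultimately show ?thesis
    unfolding states_def by (simp only: mem_Collect_eq) (auto simp: place_antiparticles_def)
qed

text \<open>
  As long as fewer than \<open>N\<close> sites are occupied there is a vacancy, and the search to the left goes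
  around the whole cycle, so it finds one.
\<close>

lemma place_particle_states:
  assumes "x \<in> states N a b" "a + b < N" "p < N"
  shows "place_particle N p x \<in> states N (Suc a) b"
proof -
  let ?P = "{i \<in> {..<N}. x i = Particle}" and ?A = "{i \<in> {..<N}. x i = Antiparticle}"
  have x: "x \<in> {..<N} \<rightarrow>\<^sub>E UNIV" "card ?P = a" "card ?A = b"
    using assms(1) by (auto simp: states_def)
  have "card (?P \<union> ?A) < card {..<N}"
    using card_Un_le[of ?P ?A] x assms(2) by simp
  then have "\<not> {..<N} \<subseteq> ?P \<union> ?A"
    using card_mono[of "?P \<union> ?A" "{..<N}"] by auto
  then obtain q where "q < N" "x q \<noteq> Particle" "x q \<noteq> Antiparticle"
    by auto
  then have q: "q < N" "x q = Vacant" by (cases "x q"; simp)+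
  show ?thesis
  proof (cases x N p rule: place_particle_cases)
    case none
    with left_of_reaches[OF assms(3) q(1)] q(2) show ?thesis by metis
  next
    case (at k)
    define c where "c = (left_of N ^^ k) p"
    have c: "c < N" "x c = Vacant"
      using at assms(3) by (auto simp: c_def funpow_left_of_less)
    have eq: "place_particle N p x = x(c := Particle)"
      using at by (simp add: place_particle_at c_def)
    have "{i \<in> {..<N}. (x(c := Particle)) i = Particle} = insert c ?P"
      "{i \<in> {..<N}. (x(c := Particle)) i = Antiparticle} = ?A"
      using c by auto
    then show ?thesis
      unfolding eq states_def mem_Collect_eq using x c
      by (auto simp: PiE_def extensional_def)
  qed
qed

lemma fold_place_particle_states:
  assumes "x \<in> states N a b" "a + length ps + b \<le> N" "set ps \<subseteq> {..<N}"
  shows "fold (place_particle N) ps x \<in> states N (a + length ps) b"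
  using assms
proof (induction ps arbitrary: a x)
  case (Cons p ps)
  then have "place_particle N p x \<in> states N (Suc a) b"
    by (intro place_particle_states) auto
  from Cons.IH[OF this] Cons.prems show ?case by simp
qed simp

lemma collapse_states:
  assumes "S \<subseteq> {..<N}" "T \<subseteq> {..<N}" "card S + card T \<le> N"
  shows "collapse N S T \<in> states N (card S) (card T)"
proof -
  have "finite S" using assms(1) finite_subset by blast
  then show ?thesis
    using fold_place_particle_states[OF place_antiparticles_states[OF assms(2)],
        of "sorted_list_of_set S"] assms
    by (simp add: collapse_def)
qed

lemma set_collapse_law:
  assumes "a + b \<le> N"
  shows "set_pmf (collapse_law N a b) \<subseteq> states N a b"
proof -
  have "{S. S \<subseteq> {..<N} \<and> card S = a} \<noteq> {}" "{T. T \<subseteq> {..<N} \<and> card T = b} \<noteq> {}"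
    using obtain_subset_with_card_n[of a "{..<N}"] obtain_subset_with_card_n[of b "{..<N}"] assms
    by auto
  moreover have "collapse N S T \<in> states N a b"
    if "S \<subseteq> {..<N}" "card S = a" "T \<subseteq> {..<N}" "card T = b" for S T
    using collapse_states[of S N T] that assms by simp
  ultimately show ?thesis
    by (auto simp: collapse_law_def set_pmf_of_set)
qed

section \<open>Uniqueness of the stationary law\<close>

lemma finite_states: "finite (states N a b)"
proof -
  have "(UNIV :: site set) = {Antiparticle, Vacant, Particle}"
    using site.exhaust by auto
  then have "finite (UNIV :: site set)" by (metis finite.emptyI finite.insertI)
  then have "finite ({..<N} \<rightarrow>\<^sub>E (UNIV :: site set))" by (intro finite_PiE) auto
  then show ?thesis unfolding states_def by (rule finite_subset[rotated]) auto
qed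

lemma edge_update_states:
  assumes "x \<in> states N a b" "i < N"
  shows "edge_update N i x \<in> states N a b"
proof -
  let ?r = "right_of N i"
  define y where "y = x(i := x ?r, ?r := x i)"
  have r: "?r < N" using assms by (simp add: right_of_less)
  have y: "y p = x (Transposition.transpose i ?r p)" for p
    by (auto simp: y_def Transposition.transpose_def)
  have perm: "Transposition.transpose i ?r permutes {..<N}"
    using assms r by (intro permutes_swap_id) auto
  have "{p \<in> {..<N}. y p = v} = Transposition.transpose i ?r ` {p \<in> {..<N}. x p = v}" for v
    using permutes_in_image[OF perm] by (fastforce simp: y intro!: image_eqI[of _ _ "Transposition.transpose i ?r _"])
  then have "card {p \<in> {..<N}. y p = v} = card {p \<in> {..<N}. x p = v}" for v
    by (simp add: card_image permutes_inj_on[OF perm])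
  moreover have "y \<in> {..<N} \<rightarrow>\<^sub>E UNIV"
    using assms r by (auto simp: y_def states_def PiE_def extensional_def)
  ultimately have "y \<in> states N a b"
    using assms(1) by (simp add: states_def)
  then show ?thesis
    using edge_update_swap[of N i x] assms(1) by (auto simp: y_def)
qed

fun site_rank :: "site \<Rightarrow> nat" where
  "site_rank Antiparticle = 0"
| "site_rank Vacant = 1"
| "site_rank Particle = 2"

definition sorted_state :: "nat \<Rightarrow> nat \<Rightarrow> nat \<Rightarrow> nat \<Rightarrow> site" where
  "sorted_state N a b =
     (\<lambda>i\<in>{..<N}. if i < b then Antiparticle else if i < N - a then Vacant else Particle)"

lemma down_closed_eq_lessThan:
  fixes A :: "nat set"
  assumes "finite A" "\<And>i j. i \<le> j \<Longrightarrow> j \<in> A \<Longrightarrow> i \<in> A"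
  shows "A = {..<card A}"
proof -
  obtain n where n: "n \<notin> A" "\<And>m. m < n \<Longrightarrow> m \<in> A"
    using ex_new_if_finite[OF infinite_UNIV_nat assms(1)] exists_least_iff[of "\<lambda>n. n \<notin> A"] by blast
  then have "A = {..<n}"
    using assms(2) by (auto simp: not_less[symmetric])
  then show ?thesis by simp
qed

lemma nondecreasing_state_eq_sorted_state:
  assumes x: "x \<in> states N a b" and mono: "\<And>i. Suc i < N \<Longrightarrow> site_rank (x i) \<le> site_rank (x (Suc i))"
  shows "x = sorted_state N a b"
proof -
  have le: "site_rank (x i) \<le> site_rank (x j)" if "i \<le> j" "j < N" for i j
    using that by (induction j rule: dec_induct) (use mono order_trans in \<open>auto intro: Suc_lessD\<close>)
  have down: "{i \<in> {..<N}. site_rank (x i) \<le> r} = {..<card {i \<in> {..<N}. site_rank (x i) \<le> r}}" for r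
    using le by (intro down_closed_eq_lessThan) (auto intro: order_trans)
  have rank_0: "site_rank u \<le> 0 \<longleftrightarrow> u = Antiparticle"
    and rank_1: "site_rank u \<le> 1 \<longleftrightarrow> u \<noteq> Particle" for u
    by (cases u; simp)+
  have "{i \<in> {..<N}. x i = Antiparticle} = {..<b}"
    using down[of 0, unfolded rank_0] x by (simp add: states_def)
  then have A: "i < N \<and> x i = Antiparticle \<longleftrightarrow> i < b" for i
    by blast
  have "card ({..<N} - {i \<in> {..<N}. x i = Particle}) = N - a"
    using x by (subst card_Diff_subset) (auto simp: states_def)
  moreover have "{..<N} - {i \<in> {..<N}. x i = Particle} = {i \<in> {..<N}. x i \<noteq> Particle}"
    by blast
  ultimately have "{i \<in> {..<N}. x i \<noteq> Particle} = {..<N - a}"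
    using down[of 1, unfolded rank_1] by simp
  then have P: "i < N \<and> x i \<noteq> Particle \<longleftrightarrow> i < N - a" for i
    by blast
  have "x i = sorted_state N a b i" for i
    using A[of i] P[of i] x
    by (cases "x i") (auto simp: sorted_state_def states_def PiE_def extensional_def)
  then show ?thesis by auto
qed

lemma sorted_state_states:
  assumes "a + b \<le> N"
  shows "sorted_state N a b \<in> states N a b"
proof -
  have "{i \<in> {..<N}. sorted_state N a b i = Particle} = {N - a..<N}"
    "{i \<in> {..<N}. sorted_state N a b i = Antiparticle} = {..<b}"
    using assms by (auto simp: sorted_state_def)
  then show ?thesis
    using assms unfolding states_def mem_Collect_eq by (auto simp: sorted_state_def)
qed

text \<open>
  An update along \<open>(i, i + 1)\<close> with \<open>i + 1 < N\<close> exchanges the two values precisely if they are out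
  of order, as in bubble sort. The weighted sum below decreases with each exchange because the larger
  value moves to the site with the smaller weight.
\<close>

lemma reaches_sorted_state:
  assumes "x \<in> states N a b"
  shows "\<exists>n. sorted_state N a b \<in> set_pmf (((\<lambda>\<nu>. bind_pmf \<nu> (tasep_jump N)) ^^ n) (return_pmf x))"
  using assms
proof (induction "\<Sum>i<N. (N - i) * site_rank (x i)" arbitrary: x rule: less_induct)
  case less
  let ?F = "\<lambda>\<nu>. bind_pmf \<nu> (tasep_jump N)" and ?s = "sorted_state N a b"
  show ?case
  proof (cases "\<exists>i. Suc i < N \<and> site_rank (x i) > site_rank (x (Suc i))")
    case False
    have "x = ?s"
    proof (rule nondecreasing_state_eq_sorted_state[OF less.prems])
      show "site_rank (x i) \<le> site_rank (x (Suc i))" if "Suc i < N" for i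
        using False that by (meson not_less)
    qed
    then show ?thesis by (intro exI[of _ 0]) simp
  next
    case True
    then obtain i where i: "Suc i < N" "site_rank (x i) > site_rank (x (Suc i))" by blast
    let ?y = "edge_update N i x"
    have r: "right_of N i = Suc i" using i by (simp add: right_of_def)
    have y: "?y = x(i := x (Suc i), Suc i := x i)"
      using i(2) by (cases "x i"; cases "x (Suc i)") (auto simp: edge_update_def r)
    have split: "(\<Sum>k<N. f k) = f i + f (Suc i) + (\<Sum>k\<in>{..<N} - {i, Suc i}. f k)" for f :: "nat \<Rightarrow> nat"
      using i by (subst sum.subset_diff[of "{i, Suc i}"]) auto
    have rest: "(\<Sum>k\<in>{..<N} - {i, Suc i}. (N - k) * site_rank (?y k)) =
        (\<Sum>k\<in>{..<N} - {i, Suc i}. (N - k) * site_rank (x k))"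
      by (intro sum.cong) (auto simp: y)
    have "N - i = Suc (N - Suc i)" using i by simp
    then have "(\<Sum>k<N. (N - k) * site_rank (?y k)) < (\<Sum>k<N. (N - k) * site_rank (x k))"
      unfolding split rest using i by (simp add: y)
    from less.hyps[OF this edge_update_states[OF less.prems]] i
    obtain n where n: "?s \<in> set_pmf ((?F ^^ n) (return_pmf ?y))" by auto
    have "?y \<in> set_pmf (tasep_jump N x)"
      using i by (auto simp: tasep_jump_def set_pmf_of_set lessThan_empty_iff)
    moreover have "(?F ^^ Suc n) (return_pmf x) =
        bind_pmf (tasep_jump N x) (\<lambda>z. (?F ^^ n) (return_pmf z))"
      by (simp only: bind_funpow_bind funpow_Suc_right o_apply bind_return_pmf)
    ultimately show ?thesis using n by (intro exI[of _ "Suc n"]) auto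
  qed
qed

lemma sorted_state_in_transition:
  assumes "N \<ge> 1" "t > 0" "x \<in> states N a b"
  shows "sorted_state N a b \<in> set_pmf (tasep_transition N t x)"
  using reaches_sorted_state[OF assms(3)] assms(1,2)
  by (auto simp: tasep_transition_def)

text \<open>
  A Doeblin argument. Let \<open>e > 0\<close> be a lower bound for the probability of jumping to \<open>s\<close>. As the
  difference \<open>d\<close> of the two laws has total mass zero, the mass \<open>e\<close> that every state sends to \<open>s\<close>
  cancels in \<open>d\<close>, and the remaining kernel has total mass at most \<open>1 - e\<close>. Hence the
  \<open>l\<^sup>1\<close> norm of \<open>d\<close> is at most \<open>1 - e\<close> times itself.
\<close>

lemma invariant_pmf_unique:
  fixes P :: "'a \<Rightarrow> 'a pmf"
  assumes "finite X" "set_pmf \<mu> \<subseteq> X" "set_pmf \<nu> \<subseteq> X"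
    and "bind_pmf \<mu> P = \<mu>" "bind_pmf \<nu> P = \<nu>"
    and s: "s \<in> X" "\<And>x. x \<in> X \<Longrightarrow> s \<in> set_pmf (P x)"
  shows "\<mu> = \<nu>"
proof -
  define d where "d = (\<lambda>x. pmf \<mu> x - pmf \<nu> x)"
  define e where "e = Min ((\<lambda>x. pmf (P x) s) ` X)"
  have e: "e > 0" "\<And>x. x \<in> X \<Longrightarrow> e \<le> pmf (P x) s"
  proof -
    have "X \<noteq> {}" using s(1) by auto
    then show "e > 0"
      unfolding e_def using s(2) assms(1) by (subst Min_gr_iff) (auto intro: pmf_positive)
    show "e \<le> pmf (P x) s" if "x \<in> X" for x
      unfolding e_def using that assms(1) by (intro Min_le) auto
  qed
  have pmf_inv: "pmf \<rho> z = (\<Sum>x\<in>X. pmf \<rho> x * pmf (P x) z)"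
    if "set_pmf \<rho> \<subseteq> X" "bind_pmf \<rho> P = \<rho>" for \<rho> z
  proof -
    have "pmf \<rho> z = pmf (bind_pmf \<rho> P) z" by (simp add: that)
    also have "\<dots> = (\<Sum>x\<in>X. pmf \<rho> x * pmf (P x) z)"
      unfolding pmf_bind using assms(1) that(1)
      by (subst integral_measure_pmf[of X]) auto
    finally show ?thesis .
  qed
  have d0: "(\<Sum>x\<in>X. d x) = 0"
    using assms by (simp add: d_def sum_subtractf sum_pmf_eq_1)
  define Q where "Q = (\<lambda>x z. pmf (P x) z - e * of_bool (z = s))"
  have Q: "Q x z \<ge> 0" if "x \<in> X" for x z
    using e that by (auto simp: Q_def)
  have dP: "d z = (\<Sum>x\<in>X. d x * pmf (P x) z)" for z
    using assms unfolding d_def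
    by (simp add: left_diff_distrib sum_subtractf pmf_inv[symmetric])
  have dQ: "d z = (\<Sum>x\<in>X. d x * Q x z)" for z
  proof -
    have "(\<Sum>x\<in>X. d x * Q x z) =
        (\<Sum>x\<in>X. d x * pmf (P x) z) - (\<Sum>x\<in>X. d x) * (e * of_bool (z = s))"
      by (simp only: Q_def right_diff_distrib sum_subtractf sum_distrib_right)
    also have "\<dots> = d z"
      unfolding d0 dP[of z, symmetric] by simp
    finally show ?thesis ..
  qed
  have Q_sum: "(\<Sum>z\<in>X. Q x z) \<le> 1 - e" for x
  proof -
    have "(\<Sum>z\<in>X. pmf (P x) z) \<le> 1"
      using measure_measure_pmf_finite[OF assms(1), of "P x"] measure_pmf.prob_le_1 by metis
    moreover have "(\<Sum>z\<in>X. e * of_bool (z = s)) = e"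
      using s(1) assms(1) by (simp add: sum.delta' of_bool_def if_distrib cong: if_cong)
    ultimately show ?thesis by (simp add: Q_def sum_subtractf)
  qed
  have "(\<Sum>z\<in>X. \<bar>d z\<bar>) \<le> (\<Sum>z\<in>X. \<Sum>x\<in>X. \<bar>d x\<bar> * Q x z)"
  proof (intro sum_mono)
    fix z
    have "\<bar>d z\<bar> \<le> (\<Sum>x\<in>X. \<bar>d x * Q x z\<bar>)" by (subst dQ) (rule sum_abs)
    also have "\<dots> = (\<Sum>x\<in>X. \<bar>d x\<bar> * Q x z)" using Q by (simp add: abs_mult)
    finally show "\<bar>d z\<bar> \<le> (\<Sum>x\<in>X. \<bar>d x\<bar> * Q x z)" .
  qed
  also have "\<dots> = (\<Sum>x\<in>X. \<bar>d x\<bar> * (\<Sum>z\<in>X. Q x z))"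
    by (subst sum.swap) (simp add: sum_distrib_left)
  also have "\<dots> \<le> (\<Sum>x\<in>X. \<bar>d x\<bar> * (1 - e))"
    by (intro sum_mono mult_left_mono Q_sum) auto
  also have "\<dots> = (1 - e) * (\<Sum>x\<in>X. \<bar>d x\<bar>)"
    by (simp add: sum_distrib_left mult.commute)
  finally have "e * (\<Sum>x\<in>X. \<bar>d x\<bar>) \<le> 0" by (simp add: algebra_simps)
  with e(1) have "(\<Sum>x\<in>X. \<bar>d x\<bar>) \<le> 0" by (simp add: mult_le_0_iff)
  moreover have "(\<Sum>x\<in>X. \<bar>d x\<bar>) \<ge> 0"
    by (intro sum_nonneg) auto
  ultimately have "(\<Sum>x\<in>X. \<bar>d x\<bar>) = 0"
    by (rule order_antisym)
  then have "\<forall>x\<in>X. d x = 0"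
    using sum_nonneg_eq_0_iff[OF assms(1), of "\<lambda>x. \<bar>d x\<bar>"] by auto
  show ?thesis
  proof (rule pmf_eqI)
    fix x
    show "pmf \<mu> x = pmf \<nu> x"
    proof (cases "x \<in> X")
      case True
      with \<open>\<forall>x\<in>X. d x = 0\<close> show ?thesis by (simp add: d_def)
    next
      case False
      then have "x \<notin> set_pmf \<mu>" "x \<notin> set_pmf \<nu>"
        using assms(2,3) by auto
      then show ?thesis
        by (simp add: set_pmf_iff)
    qed
  qed
qed

theorem theorem2p2:
  fixes N a b :: nat
  assumes "N \<ge> 1" and "a + b \<le> N"
  shows "tasep_stationary N a b (collapse_law N a b) \<and>
         (\<forall>\<mu>. tasep_stationary N a b \<mu> \<longrightarrow> \<mu> = collapse_law N a b)"
proof -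
  have stat: "tasep_stationary N a b (collapse_law N a b)"
    unfolding tasep_stationary_def
    using assms set_collapse_law collapse_law_jump_invariant jump_invariant_transition_invariant
    by blast
  moreover have "\<mu> = collapse_law N a b" if "tasep_stationary N a b \<mu>" for \<mu>
  proof (rule invariant_pmf_unique[OF finite_states])
    show "bind_pmf \<mu> (tasep_transition N 1) = \<mu>" "set_pmf \<mu> \<subseteq> states N a b"
      using that by (auto simp: tasep_stationary_def)
    show "bind_pmf (collapse_law N a b) (tasep_transition N 1) = collapse_law N a b"
      "set_pmf (collapse_law N a b) \<subseteq> states N a b"
      using stat by (auto simp: tasep_stationary_def)
    show "sorted_state N a b \<in> set_pmf (tasep_transition N 1 x)" if "x \<in> states N a b" for x
      using that assms by (intro sorted_state_in_transition) auto
    show "sorted_state N a b \<in> states N a b"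
      using assms(2) by (rule sorted_state_states)
  qed
  ultimately show ?thesis by blast
qed

end
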